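(* Let $f:\mathbb{R}\to[0,\infty)$ be a continuous function such that for some $\delta>0$ and for all $s\in[-\delta,\delta]$, $$\lim_{x\to+\infty}e^{sx}f(x)=\lim_{x\to-\infty}e^{sx}f(x)=0 .$$ Then: (i) for all $s\in(-\delta,\delta)$ the Laplace transform $M(s;f)$ of $f$ is finite; (ii) for all $k\in\mathbb{N}$, $$\lim_{x\to+\infty}x^kf(x)=\lim_{x\to-\infty}x^kf(x)=0 .$$
   Context: $\lambda$ is a $\sigma$-finite measure on $(\mathbb{R},\mathcal{B}(\mathbb{R}))$, where $\mathcal{B}(\mathbb{R})$ is the Borel $\sigma$-algebra. For a function $f:\mathbb{R}\to[0,\infty)$, the Laplace transform of $f$ is the function $M(\cdot;f):\mathbb{R}\to[0,\infty]$ given by $M(s;f)=\int_{\mathbb{R}}e^{sx}f(x)\,\lambda(dx)$. $\mathbb{N}$ denotes the positive integers.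
   Formalization: Part (i) is proved under the added assumption that ∫ e^{-ε|x|} λ(dx) is finite for every ε>0; for arbitrary σ-finite λ it fails, e.g. λ(dx)=e^{x²}dx, f(x)=e^{-x²}, where M(0;f)=∞. *)

theory Defs
  imports "HOL-Analysis.Analysis"
begin

definition laplace_transform :: "real measure \<Rightarrow> (real \<Rightarrow> real) \<Rightarrow> real \<Rightarrow> ennreal" where
  "laplace_transform L f s = (\<integral>\<^sup>+ x. ennreal (exp (s * x) * f x) \<partial>L)"

(* Sigma-finiteness alone does not make Laplace transforms of rapidly decaying functions finite:
   for L(dx) = exp(x^2) dx and f(x) = exp(-x^2) the transform of f is infinite at 0.
   The condition below is what finiteness on (-\<delta>, \<delta>) additionally needs. It holds for Lebesgue
   measure and for counting measure on the integers, and it cannot be relaxed: for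
   f(x) = exp(-\<delta> |x|) / (1 + |x|), which meets the limit conditions on [-\<delta>, \<delta>], finiteness of
   the transform for all s in (-\<delta>, \<delta>) forces it. *)
definition integrates_exponential_decay :: "real measure \<Rightarrow> bool" where
  "integrates_exponential_decay L \<longleftrightarrow>
     (\<forall>\<epsilon>>0. (\<integral>\<^sup>+ x. ennreal (exp (- \<epsilon> * \<bar>x\<bar>)) \<partial>L) < \<infinity>)"

end

theory Submission
  imports Defs "HOL-Real_Asymp.Real_Asymp"
begin

text \<open>The limits for the exponents \<delta> at the right end and -\<delta> at the left end say
  that exp (\<delta> * \<bar>x\<bar>) * f x vanishes at both infinities. Being continuous, this
  product is bounded, so f x \<le> B * exp (- \<delta> * \<bar>x\<bar>) for all x; this is
  \<open>exponential_decay_bound\<close>. Both claims follow from this one estimate. For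
  \<bar>s\<bar> < \<delta> the factor exp (s * x) uses up only part of the decay, and
  \<open>integrates_exponential_decay\<close> makes the integral of the remainder finite. The power
  limits hold because an exponential beats every power of \<bar>x\<bar>.\<close>

lemma bounded_range_if_tendsto_0_at_infinities:
  fixes g :: "real \<Rightarrow> real"
  assumes cont: "continuous_on UNIV g"
    and top: "(g \<longlongrightarrow> 0) at_top" and bot: "(g \<longlongrightarrow> 0) at_bot"
  obtains B where "\<And>x. \<bar>g x\<bar> \<le> B"
proof -
  have "\<forall>\<^sub>F x in at_top. \<bar>g x\<bar> < 1" "\<forall>\<^sub>F x in at_bot. \<bar>g x\<bar> < 1"
    using tendstoD[OF top, of 1] tendstoD[OF bot, of 1] by simp_all
  then obtain a b where tails: "\<And>x. a \<le> x \<Longrightarrow> \<bar>g x\<bar> < 1" "\<And>x. x \<le> b \<Longrightarrow> \<bar>g x\<bar> < 1"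
    by (auto simp: eventually_at_top_linorder eventually_at_bot_linorder)
  have "compact (g ` {b..a})"
    by (intro compact_continuous_image continuous_on_subset[OF cont]) auto
  then obtain C where "\<forall>y\<in>g ` {b..a}. \<bar>y\<bar> \<le> C"
    using compact_imp_bounded bounded_real by metis
  \<comment> \<open>The 1 covers both tails and \<open>C\<close> the middle. If b > a, the interval
    is empty and the two tails already cover the line.\<close>
  with tails have "\<bar>g x\<bar> \<le> max 1 C" for x
    by (cases "x \<in> {b..a}") (force simp: less_imp_le max.coboundedI1 max.coboundedI2)+
  then show thesis
    by (rule that)
qed

text \<open>The weight exp (\<delta> * \<bar>x\<bar>) equals exp (\<delta> * x) for x \<ge> 0 and
  exp (- \<delta> * x) for x \<le> 0. It thus glues the two one-sided hypotheses into one continuous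
  function that vanishes at both ends; dividing its bound by the weight gives the estimate.\<close>

lemma exponential_decay_bound:
  fixes f :: "real \<Rightarrow> real"
  assumes cont: "continuous_on UNIV f" and nonneg: "\<And>x. 0 \<le> f x"
    and top: "((\<lambda>x. exp (\<delta> * x) * f x) \<longlongrightarrow> 0) at_top"
    and bot: "((\<lambda>x. exp (- \<delta> * x) * f x) \<longlongrightarrow> 0) at_bot"
  obtains B where "0 \<le> B" "\<And>x. f x \<le> B * exp (- \<delta> * \<bar>x\<bar>)"
proof -
  let ?g = "\<lambda>x. exp (\<delta> * \<bar>x\<bar>) * f x"
  have "continuous_on UNIV ?g"
    by (intro continuous_intros cont)
  moreover have "(?g \<longlongrightarrow> 0) at_top"
    using top by (rule Lim_transform_eventually)
      (auto intro: eventually_mono[OF eventually_ge_at_top[of 0]])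
  moreover have "(?g \<longlongrightarrow> 0) at_bot"
    using bot by (rule Lim_transform_eventually)
      (auto intro: eventually_mono[OF eventually_le_at_bot[of 0]])
  ultimately obtain B where B: "\<And>x. \<bar>?g x\<bar> \<le> B"
    using bounded_range_if_tendsto_0_at_infinities[of ?g] by blast
  have "f x \<le> B * exp (- \<delta> * \<bar>x\<bar>)" for x
    using B[of x] nonneg[of x] by (simp add: abs_mult exp_minus field_simps)
  moreover have "0 \<le> B"
    using B[of 0] by linarith
  ultimately show thesis
    using that by blast
qed

theorem proposition3:
  fixes L :: "real measure" and f :: "real \<Rightarrow> real" and \<delta> :: real
  assumes "sigma_finite_measure L" and "sets L = sets borel"
    and "continuous_on UNIV f" and "\<And>x. 0 \<le> f x"
    and "0 < \<delta>"
    and "\<And>s. s \<in> {-\<delta>..\<delta>} \<Longrightarrow>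
           ((\<lambda>x. exp (s * x) * f x) \<longlongrightarrow> 0) at_top \<and> ((\<lambda>x. exp (s * x) * f x) \<longlongrightarrow> 0) at_bot"
  shows "(integrates_exponential_decay L \<longrightarrow>
            (\<forall>s\<in>{-\<delta><..<\<delta>}. laplace_transform L f s < \<infinity>)) \<and>
         (\<forall>k::nat. 1 \<le> k \<longrightarrow>
            ((\<lambda>x. x ^ k * f x) \<longlongrightarrow> 0) at_top \<and> ((\<lambda>x. x ^ k * f x) \<longlongrightarrow> 0) at_bot)"
proof (intro conjI impI ballI allI)
  obtain B where B: "0 \<le> B" "\<And>x. f x \<le> B * exp (- \<delta> * \<bar>x\<bar>)"
    using exponential_decay_bound[of f \<delta>] assms(3-5) assms(6)[of \<delta>] assms(6)[of "-\<delta>"] by auto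
  {
    fix s assume decay: "integrates_exponential_decay L" and s: "s \<in> {-\<delta><..<\<delta>}"
    \<comment> \<open>The decay rate left over once exp (s * x) \<le> exp (\<bar>s\<bar> *
      \<bar>x\<bar>) is absorbed. It is positive because s lies in the open interval.\<close>
    let ?\<epsilon> = "\<delta> - \<bar>s\<bar>"
    have le: "exp (s * x) * f x \<le> B * exp (- ?\<epsilon> * \<bar>x\<bar>)" for x
    proof -
      have "s * x \<le> \<bar>s\<bar> * \<bar>x\<bar>"
        by (metis abs_ge_self abs_mult)
      then have "exp (s * x) * f x \<le> exp (\<bar>s\<bar> * \<bar>x\<bar>) * (B * exp (- \<delta> * \<bar>x\<bar>))"
        using B(2)[of x] assms(4)[of x] by (intro mult_mono) auto
      also have "\<dots> = B * exp (- ?\<epsilon> * \<bar>x\<bar>)"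
        by (simp add: algebra_simps flip: exp_add)
      finally show ?thesis .
    qed
    \<comment> \<open>Borel measurability carries over to \<open>L\<close> through the equality of
      sigma-algebras; it is what lets the constant \<open>B\<close> be pulled out of the
      integral.\<close>
    have [measurable]: "(\<lambda>x. ennreal (exp (- ?\<epsilon> * \<bar>x\<bar>))) \<in> borel_measurable L"
      unfolding measurable_cong_sets[OF assms(2) refl] by measurable
    have "laplace_transform L f s \<le> (\<integral>\<^sup>+ x. ennreal B * ennreal (exp (- ?\<epsilon> * \<bar>x\<bar>)) \<partial>L)"
      unfolding laplace_transform_def
      using le B(1) by (intro nn_integral_mono) (simp flip: ennreal_mult add: ennreal_leI)
    also have "\<dots> = ennreal B * (\<integral>\<^sup>+ x. ennreal (exp (- ?\<epsilon> * \<bar>x\<bar>)) \<partial>L)"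
      by (rule nn_integral_cmult) measurable
    also have "\<dots> < \<infinity>"
    proof -
      have "0 < ?\<epsilon>"
        using s by auto
      then have "(\<integral>\<^sup>+ x. ennreal (exp (- ?\<epsilon> * \<bar>x\<bar>)) \<partial>L) < \<infinity>"
        using decay unfolding integrates_exponential_decay_def by blast
      then show ?thesis
        by (simp add: ennreal_mult_less_top)
    qed
    finally show "laplace_transform L f s < \<infinity>" .
  }
  fix k :: nat
  \<comment> \<open>Stated in y, which stands for \<bar>x\<bar>, so that one limit serves both ends
    of the line.\<close>
  have lim: "((\<lambda>y. B * (y ^ k * exp (- \<delta> * y))) \<longlongrightarrow> 0) at_top"
    using \<open>0 < \<delta>\<close> by real_asymp
  have bound: "norm (x ^ k * f x) \<le> B * (\<bar>x\<bar> ^ k * exp (- \<delta> * \<bar>x\<bar>))" for x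
    using mult_left_mono[OF B(2)[of x], of "\<bar>x\<bar> ^ k"] assms(4)[of x]
    by (simp add: abs_mult power_abs mult.left_commute)
  \<comment> \<open>Composing \<open>lim\<close> with \<open>abs\<close> and squeezing by
    \<open>bound\<close> works along any filter on which \<bar>x\<bar> tends to infinity, in
    particular \<open>at_top\<close> and \<open>at_bot\<close>.\<close>
  have "((\<lambda>x. x ^ k * f x) \<longlongrightarrow> 0) F" if "filterlim abs at_top F" for F
    using bound by (intro Lim_null_comparison[OF always_eventually filterlim_compose[OF lim that]]) blast
  moreover have "filterlim abs at_top (at_top :: real filter)" "filterlim abs at_top (at_bot :: real filter)"
    by real_asymp+
  ultimately show "((\<lambda>x. x ^ k * f x) \<longlongrightarrow> 0) at_top" "((\<lambda>x. x ^ k * f x) \<longlongrightarrow> 0) at_bot"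
    by blast+
qed

end
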